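(* For every set $P$ of $n\ge 5$ points in general position in the plane, it holds that $$\mathrm{force}(n;P)=\Theta(\log n).$$ That is, there are constants $c_1,c_2>0$ such that for every $n\ge 5$ and every set $P$ of $n$ points in general position, $c_1\log n\le \mathrm{force}(n;P)\le c_2\log n$.
   Context: A point set in the plane is in general position if no three of its points are collinear. A labeling of a set of $n$ points is a bijection between the points and $\{1,\dots,n\}$. A matching is a set of pairwise disjoint 2-element subsets (edges) of $\{1,\dots,n\}$. It is compatible to several labeled point sets if, on each of them, its straight-line drawing (edge $\{a,b\}$ drawn as the segment between the points labeled $a$ and $b$) is crossing-free. For an unlabeled set $P$ of $n$ points, $\mathrm{force}(n;P)$ is the minimum integer $\ell$ such that there exist $\ell$ labelings of $P$ for which every matching compatible to all $\ell$ resulting labeled copies of $P$ has at most one edge; $\mathrm{force}(n;P)=\infty$ if no such $\ell$ exists. *)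

theory Defs
  imports "HOL-Analysis.Analysis"
begin

type_synonym point = "real ^ 2"

definition general_position :: "point set \<Rightarrow> bool" where
  "general_position P \<longleftrightarrow> (\<forall>S. S \<subseteq> P \<and> card S = 3 \<longrightarrow> \<not> collinear S)"

(* A labeling is represented by the map from labels to points: p a is the point labeled a.
   Values outside {1..n} are irrelevant. *)
definition labeling :: "nat \<Rightarrow> point set \<Rightarrow> (nat \<Rightarrow> point) \<Rightarrow> bool" where
  "labeling n P p \<longleftrightarrow> bij_betw p {1..n} P"

definition matching :: "nat \<Rightarrow> nat set set \<Rightarrow> bool" where
  "matching n M \<longleftrightarrow> (\<forall>e\<in>M. e \<subseteq> {1..n} \<and> card e = 2) \<and> pairwise disjnt M"

(* Two distinct edges may meet only in common endpoints; for the edges of a matching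
   this means that the closed segments are disjoint. *)
definition crossing_free :: "(nat \<Rightarrow> point) \<Rightarrow> nat set set \<Rightarrow> bool" where
  "crossing_free p M \<longleftrightarrow>
     (\<forall>a b c d. {a, b} \<in> M \<and> {c, d} \<in> M \<and> {a, b} \<noteq> {c, d} \<longrightarrow>
        closed_segment (p a) (p b) \<inter> closed_segment (p c) (p d) \<subseteq> p ` ({a, b} \<inter> {c, d}))"

(* The l labelings are L 0, ..., L (l - 1). Repetitions are allowed; they do not affect the
   least possible l, since repeated labelings can be dropped. *)
definition forcing_labelings :: "nat \<Rightarrow> point set \<Rightarrow> nat \<Rightarrow> (nat \<Rightarrow> nat \<Rightarrow> point) \<Rightarrow> bool" where
  "forcing_labelings n P l L \<longleftrightarrow>
     (\<forall>i<l. labeling n P (L i)) \<and>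
     (\<forall>M. matching n M \<and> (\<forall>i<l. crossing_free (L i) M) \<longrightarrow> card M \<le> 1)"

(* In enat, the infimum of a nonempty set is its minimum and the infimum of {} is \<infinity>. *)
definition force :: "nat \<Rightarrow> point set \<Rightarrow> enat" where
  "force n P = Inf {enat l | l. \<exists>L. forcing_labelings n P l L}"

end

theory Submission
  imports Defs "HOL-Combinatorics.Permutations"
begin

text \<open>
  Lower bound: in each of the \<open>l\<close> labeled copies, record on which side of the line through the points
  labeled 1 and 2 every other point lies. If \<open>2 ^ l < n - 2\<close>, two labels \<open>c\<close> and \<open>d\<close> have the same
  record, and then the edges \<open>{1, 2}\<close> and \<open>{c, d}\<close> never cross.

  Upper bound: five points in general position always span two crossing segments. Hence, permuting
  five labels, at least a fraction 1/120 of all labelings makes two given disjoint edges cross, and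
  so some labeling makes this fraction of any given family of pairs of edges cross. Choosing
  labelings greedily, all of the at most \<open>n ^ 4\<close> pairs cross at some point after
  \<open>O(log n)\<close> rounds.
\<close>

section \<open>Orientation and crossing segments\<close>

text \<open>Twice the signed area of the triangle \<open>a b c\<close>. It is affine in each
  argument, and its sign as a function of \<open>c\<close> tells the side of the line through
  \<open>a\<close> and \<open>b\<close>.\<close>

definition orient :: "point \<Rightarrow> point \<Rightarrow> point \<Rightarrow> real" where
  "orient a b c = (b$1 - a$1) * (c$2 - a$2) - (b$2 - a$2) * (c$1 - a$1)"

text \<open>Proper crossing: each segment has its endpoints strictly on opposite sides of the line
  through the other.\<close>

definition crosses :: "point \<Rightarrow> point \<Rightarrow> point \<Rightarrow> point \<Rightarrow> bool" where
  "crosses a b c d \<longleftrightarrow> orient a b c * orient a b d < 0 \<and> orient c d a * orient c d b < 0"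

lemma orient_collinear:
  assumes "orient a b c = 0"
  shows "collinear {a, b, c}"
proof (cases "a = b")
  case False
  have prod: "(b$1 - a$1) * (c$2 - a$2) = (b$2 - a$2) * (c$1 - a$1)"
    using assms by (simp add: orient_def)
  have "\<exists>r. c - a = r *\<^sub>R (b - a)"
  proof (cases "b$1 = a$1")
    case True
    then have "b$2 - a$2 \<noteq> 0" using False by (simp add: vec_eq_iff forall_2)
    with True prod show ?thesis
      by (intro exI[of _ "(c$2 - a$2) / (b$2 - a$2)"]) (simp add: vec_eq_iff forall_2)
  next
    case False
    with prod show ?thesis
      by (intro exI[of _ "(c$1 - a$1) / (b$1 - a$1)"])
        (simp add: vec_eq_iff forall_2 nonzero_eq_divide_eq mult.commute)
  qed
  then have "collinear {0, b - a, c - a}"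
    by (auto simp: collinear_lemma)
  then have "collinear {b, a, c}"
    by (subst collinear_3) auto
  then show ?thesis
    by (simp add: insert_commute)
qed auto

lemma crosses_imp_segments_meet:
  assumes "crosses a b c d"
  shows "closed_segment a b \<inter> closed_segment c d \<noteq> {}"
proof -
  have *: "orient a b c * orient a b d < 0" "orient c d a * orient c d b < 0"
    using assms by (auto simp: crosses_def)
  \<comment> \<open>Along the segment from \<open>a\<close> to \<open>b\<close> the affine function
    \<open>orient c d\<close> vanishes at parameter \<open>t\<close>; likewise
    \<open>orient a b\<close> vanishes at \<open>s\<close> on the segment from \<open>c\<close> to
    \<open>d\<close>.\<close>
  define t where "t = orient c d a / (orient c d a - orient c d b)"
  define s where "s = orient a b c / (orient a b c - orient a b d)"
  have dt: "orient c d a - orient c d b \<noteq> 0" and ds: "orient a b c - orient a b d \<noteq> 0"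
    using * by (auto simp: mult_less_0_iff)
  have t: "0 \<le> t" "t \<le> 1" and s: "0 \<le> s" "s \<le> 1"
    using * by (auto simp: t_def s_def mult_less_0_iff divide_simps)
  \<comment> \<open>The two denominators agree up to sign, so multiplying by the single number
    \<open>D\<close> clears both and leaves a polynomial identity in the coordinates.\<close>
  have e: "orient c d a - orient c d b = - (orient a b c - orient a b d)"
    by (simp add: orient_def algebra_simps)
  have "(1 - t) *\<^sub>R a + t *\<^sub>R b = (1 - s) *\<^sub>R c + s *\<^sub>R d"
  proof -
    define D where "D = orient a b c - orient a b d"
    have D: "D \<noteq> 0" using ds D_def by simp
    have "t * (orient c d a - orient c d b) = orient c d a" using dt by (simp add: t_def)
    then have tD: "t * D = - orient c d a" by (simp only: e D_def mult_minus_right)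
    have sD: "s * D = orient a b c" using ds by (simp add: s_def D_def)
    have "D * ((1 - t) * a$i + t * b$i) = D * ((1 - s) * c$i + s * d$i)" for i
    proof -
      have "D * ((1 - t) * a$i + t * b$i) = D * a$i + (t * D) * (b$i - a$i)"
        by (simp add: algebra_simps)
      moreover have "D * ((1 - s) * c$i + s * d$i) = D * c$i + (s * D) * (d$i - c$i)"
        by (simp add: algebra_simps)
      moreover have "D * a$i - orient c d a * (b$i - a$i) = D * c$i + orient a b c * (d$i - c$i)"
        using exhaust_2[of i] by (auto simp: D_def orient_def algebra_simps)
      ultimately show ?thesis by (simp add: tD sD)
    qed
    with D show ?thesis by (simp add: vec_eq_iff)
  qed
  with s t show ?thesis
    by (auto simp: in_segment set_eq_iff)
qed

text \<open>The affine function \<open>orient a b\<close> is zero on the first segment and keeps a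
  strict sign on the second.\<close>

lemma same_side_imp_segments_disjoint:
  assumes "orient a b c > 0 \<and> orient a b d > 0 \<or> orient a b c < 0 \<and> orient a b d < 0"
  shows "closed_segment a b \<inter> closed_segment c d = {}"
proof -
  have "orient a b ((1 - t) *\<^sub>R a + t *\<^sub>R b) = 0" for t
    by (simp add: orient_def algebra_simps)
  then have ab: "orient a b x = 0" if "x \<in> closed_segment a b" for x
    using that by (auto simp: in_segment)
  have aff: "orient a b ((1 - t) *\<^sub>R c + t *\<^sub>R d) = (1 - t) * orient a b c + t * orient a b d" for t
    by (simp add: orient_def algebra_simps)
  have cd: "orient a b x \<noteq> 0" if "x \<in> closed_segment c d" for x
  proof -
    obtain t where t: "0 \<le> t" "t \<le> 1" "x = (1 - t) *\<^sub>R c + t *\<^sub>R d"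
      using \<open>x \<in> closed_segment c d\<close> by (auto simp: in_segment)
    show ?thesis
      using assms
    proof
      assume "orient a b c > 0 \<and> orient a b d > 0"
      then show ?thesis using t aff[of t] convex_bound_lt[of "- orient a b c" 0 "- orient a b d" "1 - t" t]
        by auto
    next
      assume "orient a b c < 0 \<and> orient a b d < 0"
      then show ?thesis using t aff[of t] convex_bound_lt[of "orient a b c" 0 "orient a b d" "1 - t" t]
        by auto
    qed
  qed
  from ab cd show ?thesis by blast
qed


section \<open>Crossings among four and five points\<close>

text \<open>The numbers \<open>orient b c d\<close>, \<open>- orient a c d\<close>,
  \<open>orient a b d\<close>, \<open>- orient a b c\<close> are the coefficients of an affine
  dependence of \<open>a\<close>, \<open>b\<close>, \<open>c\<close>, \<open>d\<close>. They sum to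
  0 and have positive product, so two are positive and two negative. The points split accordingly
  into two pairs (a Radon partition), whose segments cross.\<close>

lemma four_points_crossing:
  assumes pos: "orient a b c * orient a b d * orient a c d * orient b c d > 0"
  shows "crosses a b c d \<or> crosses a c b d \<or> crosses a d b c"
proof -
  \<comment> \<open>All orientations occurring in the three alternatives are reduced to the four
    with alphabetically ordered arguments.\<close>
  have eqs: "orient c d a = orient a c d" "orient c d b = orient b c d" "orient a c b = - orient a b c"
    "orient b d a = orient a b d" "orient b d c = - orient b c d" "orient a d b = - orient a b d"
    "orient a d c = - orient a c d" "orient b c a = orient a b c"
    by (simp_all add: orient_def algebra_simps)
  have "orient b c d - orient a c d + orient a b d - orient a b c = 0"
    by (simp add: orient_def algebra_simps)
  with pos show ?thesis
    by (auto simp: crosses_def eqs mult_less_0_iff zero_less_mult_iff)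
qed

text \<open>Each of the ten triples lies in exactly two of the five quadruples, so the product of the
  five sign products is positive, and hence some quadruple has a positive one.\<close>

lemma five_points_crossing:
  assumes nz: "orient a b c \<noteq> 0" "orient a b d \<noteq> 0" "orient a b e \<noteq> 0" "orient a c d \<noteq> 0"
    "orient a c e \<noteq> 0" "orient a d e \<noteq> 0" "orient b c d \<noteq> 0" "orient b c e \<noteq> 0"
    "orient b d e \<noteq> 0" "orient c d e \<noteq> 0"
  shows "crosses a b c d \<or> crosses a c b d \<or> crosses a d b c \<or>
    crosses a b c e \<or> crosses a c b e \<or> crosses a e b c \<or>
    crosses a b d e \<or> crosses a d b e \<or> crosses a e b d \<or>
    crosses a c d e \<or> crosses a d c e \<or> crosses a e c d \<or>
    crosses b c d e \<or> crosses b d c e \<or> crosses b e c d"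
proof -
  define Q where "Q x y z w = orient x y z * orient x y w * orient x z w * orient y z w" for x y z w
  have "Q a b c d * Q a b c e * Q a b d e * Q a c d e * Q b c d e =
    (orient a b c * orient a b d * orient a b e * orient a c d * orient a c e *
      orient a d e * orient b c d * orient b c e * orient b d e * orient c d e)\<^sup>2"
    unfolding Q_def power2_eq_square by (simp only: ac_simps)
  also have "\<dots> > 0" using nz by simp
  finally have "Q a b c d > 0 \<or> Q a b c e > 0 \<or> Q a b d e > 0 \<or> Q a c d e > 0 \<or> Q b c d e > 0"
    by (auto simp: zero_less_mult_iff mult_less_0_iff)
  then show ?thesis
    using four_points_crossing unfolding Q_def by blast
qed

section \<open>Greedy covering\<close>

text \<open>Every target is hit by at least a fraction \<open>1 / k\<close> of \<open>B\<close>. By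
  averaging, some element of \<open>B\<close> hits that fraction of the targets still missed;
  choosing it multiplies their number by at most \<open>1 - 1 / k\<close>.\<close>

lemma greedy_cover:
  fixes R :: "'b \<Rightarrow> 'u \<Rightarrow> bool" and k :: nat
  assumes "finite B" "finite U" "B \<noteq> {}" "k > 0"
    and dense: "\<And>t. t \<in> U \<Longrightarrow> card B \<le> k * card {p \<in> B. R p t}"
  shows "\<exists>L. (\<forall>i<l. L i \<in> B) \<and>
    real (card {t \<in> U. \<forall>i<l. \<not> R (L i) t}) \<le> (1 - 1 / k) ^ l * card U"
proof (induction l)
  case 0
  then show ?case by simp
next
  case (Suc l)
  then obtain L :: "nat \<Rightarrow> 'b" where L: "\<forall>i<l. L i \<in> B"
    and cL: "real (card {t \<in> U. \<forall>i<l. \<not> R (L i) t}) \<le> (1 - 1 / k) ^ l * card U"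
    by blast
  define V where "V = {t \<in> U. \<forall>i<l. \<not> R (L i) t}"
  have V: "finite V" "V \<subseteq> U" using assms(2) by (auto simp: V_def)
  \<comment> \<open>Double counting of the pairs \<open>p\<close>, \<open>t\<close> with
    \<open>R p t\<close>: were every \<open>p\<close> below average, the count would contradict
    \<open>dense\<close>.\<close>
  have "\<exists>p\<in>B. card V \<le> k * card {t \<in> V. R p t}"
  proof (rule ccontr)
    assume "\<not> ?thesis"
    then have "(\<Sum>p\<in>B. k * card {t \<in> V. R p t}) < (\<Sum>p\<in>B. card V)"
      using assms by (intro sum_strict_mono) auto
    also have "\<dots> = (\<Sum>t\<in>V. card B)" by simp
    also have "\<dots> \<le> (\<Sum>t\<in>V. k * card {p \<in> B. R p t})"
      using dense V by (intro sum_mono) auto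
    also have "\<dots> = (\<Sum>p\<in>B. k * card {t \<in> V. R p t})"
      using sum.swap_restrict[OF assms(1) V(1), of "\<lambda>_ _. 1::nat" R]
      by (simp flip: sum_distrib_left)
    finally show False by simp
  qed
  then obtain p where p: "p \<in> B" "card V \<le> k * card {t \<in> V. R p t}" by blast
  have "card {t \<in> V. R p t} + card {t \<in> V. \<not> R p t} = card V"
    using V(1) by (subst card_Un_disjoint[symmetric]) (auto intro: arg_cong[where f = card])
  then have "real (card {t \<in> V. R p t}) + card {t \<in> V. \<not> R p t} = card V"
    by (metis of_nat_add)
  moreover have "real (card V) \<le> k * card {t \<in> V. R p t}"
    using p(2) by (metis of_nat_le_iff of_nat_mult)
  then have "real (card V) / k \<le> card {t \<in> V. R p t}"
    using \<open>k > 0\<close> by (simp add: field_simps)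
  ultimately have "real (card {t \<in> V. \<not> R p t}) \<le> (1 - 1 / k) * card V"
    by (simp add: algebra_simps)
  also have "\<dots> \<le> (1 - 1 / k) * ((1 - 1 / k) ^ l * card U)"
    using cL \<open>k > 0\<close> by (intro mult_left_mono) (auto simp: V_def)
  finally have "real (card {t \<in> V. \<not> R p t}) \<le> (1 - 1 / k) ^ Suc l * card U"
    by simp
  moreover have "{t \<in> V. \<not> R p t} = {t \<in> U. \<forall>i<Suc l. \<not> R ((L(l := p)) i) t}"
    by (auto simp: V_def less_Suc_eq)
  moreover have "\<forall>i<Suc l. (L(l := p)) i \<in> B"
    using L p(1) by (auto simp: less_Suc_eq)
  ultimately show ?case
    by (intro exI[of _ "L(l := p)"]) (simp only: simp_thms)
qed

section \<open>Density of the labelings with a crossing\<close>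

lemma general_position_orient:
  assumes "general_position P" "a \<in> P" "b \<in> P" "c \<in> P" "a \<noteq> b" "a \<noteq> c" "b \<noteq> c"
  shows "orient a b c \<noteq> 0"
  using assms orient_collinear[of a b c] unfolding general_position_def
  by (elim allE[of _ "{a, b, c}"]) auto

text \<open>The crossing found among five points may involve any four of the labels;
  \<open>s\<close> moves it to the prescribed edges \<open>{a, b}\<close> and
  \<open>{c, d}\<close>.\<close>

lemma crossing_rearrangement:
  assumes gp: "general_position P" and inj: "inj_on p {a, b, c, d, e}"
    and sub: "p ` {a, b, c, d, e} \<subseteq> P" and dist: "distinct [a, b, c, d, e]"
  obtains s where "s permutes {a, b, c, d, e}"
    and "crosses (p (s a)) (p (s b)) (p (s c)) (p (s d))"
proof -
  let ?S = "{a, b, c, d, e}"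
  have "orient (p x) (p y) (p z) \<noteq> 0"
    if "x \<in> ?S" "y \<in> ?S" "z \<in> ?S" "x \<noteq> y" "x \<noteq> z" "y \<noteq> z" for x y z
  proof (rule general_position_orient[OF gp])
    show "p x \<in> P" "p y \<in> P" "p z \<in> P"
      using that(1-3) sub by blast+
    show "p x \<noteq> p y" "p x \<noteq> p z" "p y \<noteq> p z"
      using that inj_on_eq_iff[OF inj] by metis+
  qed
  then have "crosses (p a) (p b) (p c) (p d) \<or> crosses (p a) (p c) (p b) (p d) \<or> crosses (p a) (p d) (p b) (p c) \<or>
    crosses (p a) (p b) (p c) (p e) \<or> crosses (p a) (p c) (p b) (p e) \<or> crosses (p a) (p e) (p b) (p c) \<or>
    crosses (p a) (p b) (p d) (p e) \<or> crosses (p a) (p d) (p b) (p e) \<or> crosses (p a) (p e) (p b) (p d) \<or>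
    crosses (p a) (p c) (p d) (p e) \<or> crosses (p a) (p d) (p c) (p e) \<or> crosses (p a) (p e) (p c) (p d) \<or>
    crosses (p b) (p c) (p d) (p e) \<or> crosses (p b) (p d) (p c) (p e) \<or> crosses (p b) (p e) (p c) (p d)"
    using dist by (intro five_points_crossing) auto
  then obtain a' b' c' d' where cr: "crosses (p a') (p b') (p c') (p d')"
    and sub': "{a', b', c', d'} \<subseteq> ?S" and dist': "distinct [a', b', c', d']"
  proof -
    assume R: "\<And>u v w x. crosses (p u) (p v) (p w) (p x) \<Longrightarrow> {u, v, w, x} \<subseteq> ?S \<Longrightarrow>
      distinct [u, v, w, x] \<Longrightarrow> thesis"
    show thesis
      using \<open>_ \<or> _\<close> by - ((elim disjE; erule R), use dist in auto)
  qed
  \<comment> \<open>The single label left over becomes the image of \<open>e\<close>, which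
    completes \<open>s\<close> to a permutation of the five labels.\<close>
  have "card (?S - {a', b', c', d'}) = 1"
  proof -
    have "card ?S = 5" "card {a', b', c', d'} = 4"
      using dist dist' by simp_all
    then show ?thesis by (subst card_Diff_subset[OF _ sub']) simp_all
  qed
  then obtain e' where e': "?S - {a', b', c', d'} = {e'}"
    by (rule card_1_singletonE)
  with sub' have S': "{a', b', c', d', e'} = ?S"
    by blast
  define s where "s x = (if x = a then a' else if x = b then b' else if x = c then c'
    else if x = d then d' else if x = e then e' else x)" for x
  have s: "s a = a'" "s b = b'" "s c = c'" "s d = d'" "s e = e'"
    using dist by (auto simp: s_def)
  have "s permutes ?S"
  proof (rule bij_imp_permutes)
    have "s ` ?S = ?S" using s S' by simp
    moreover from this have "inj_on s ?S" by (intro eq_card_imp_inj_on) (simp_all only: finite.intros)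
    ultimately show "bij_betw s ?S ?S" by (rule bij_betw_imageI[rotated])
  qed (auto simp: s_def)
  with cr s that show thesis by simp
qed

text \<open>Labelings are written as \<open>p \<circ> s\<close> with \<open>p\<close> fixed. Each
  \<open>s\<close> is brought into the good set by composing with one of the 5! = 120 permutations
  of five labels, and for a fixed such permutation this composition is injective in
  \<open>s\<close>.\<close>

lemma crossing_permutations_dense:
  fixes n :: nat
  assumes gp: "general_position P" and p: "bij_betw p {1..n} P" and n: "n \<ge> 5"
    and t: "{a, b, c, d} \<subseteq> {1..n}" "distinct [a, b, c, d]"
  shows "card {s. s permutes {1..n}} \<le>
    120 * card {s. s permutes {1..n} \<and> crosses (p (s a)) (p (s b)) (p (s c)) (p (s d))}"
proof -
  define G where "G = {s. s permutes {1..n} \<and> crosses (p (s a)) (p (s b)) (p (s c)) (p (s d))}"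
  have finG: "finite G"
    unfolding G_def by (rule finite_subset[OF _ finite_permutations[OF finite_atLeastAtMost[of 1 n]]]) auto
  \<comment> \<open>The assumption \<open>n \<ge> 5\<close> supplies the fifth label.\<close>
  have "card {a, b, c, d} < card {1..n}" using t n by simp
  then obtain e where e: "e \<in> {1..n}" "e \<notin> {a, b, c, d}"
    by (meson card_mono finite.intros finite_insert linorder_not_less subsetI)
  let ?S = "{a, b, c, d, e}"
  let ?T = "{u. u permutes ?S}"
  have S: "?S \<subseteq> {1..n}" "distinct [a, b, c, d, e]" using t e by auto
  have cardT: "card ?T = 120" and finT: "finite ?T"
    using S(2) by (auto simp: card_permutations[OF refl] fact_numeral finite_permutations)
  have cov: "{s. s permutes {1..n}} \<subseteq> (\<Union>u\<in>?T. {s. s \<circ> u \<in> G \<and> s permutes {1..n}})"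
  proof
    fix s assume "s \<in> {s. s permutes {1..n}}"
    then have s: "s permutes {1..n}" by simp
    have bij: "bij_betw (p \<circ> s) {1..n} P"
      using bij_betw_trans[OF permutes_imp_bij[OF s] p] .
    then have "inj_on (p \<circ> s) ?S" "(p \<circ> s) ` ?S \<subseteq> P"
      using S(1) by (metis bij_betw_def inj_on_subset, metis bij_betw_def image_mono)
    then obtain u where u: "u permutes ?S"
      "crosses ((p \<circ> s) (u a)) ((p \<circ> s) (u b)) ((p \<circ> s) (u c)) ((p \<circ> s) (u d))"
      using crossing_rearrangement[OF gp _ _ S(2)] by metis
    have "s \<circ> u permutes {1..n}"
      using permutes_compose[OF permutes_subset[OF u(1) S(1)] s] .
    with u s show "s \<in> (\<Union>u\<in>?T. {s. s \<circ> u \<in> G \<and> s permutes {1..n}})"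
      by (auto simp: G_def)
  qed
  have each: "card {s. s \<circ> u \<in> G \<and> s permutes {1..n}} \<le> card G" if "u \<in> ?T" for u
  proof (rule card_inj_on_le[where f = "\<lambda>s. s \<circ> u"])
    have "surj u" using that by (auto dest: permutes_surj)
    then show "inj_on (\<lambda>s. s \<circ> u) {s. s \<circ> u \<in> G \<and> s permutes {1..n}}"
      by (intro inj_onI) (auto simp: fun_eq_iff surj_def, metis)
  qed (use finG in auto)
  have "card {s. s permutes {1..n}} \<le> card (\<Union>u\<in>?T. {s. s \<circ> u \<in> G \<and> s permutes {1..n}})"
    using cov by (rule card_mono[rotated])
      (auto intro!: finT finite_subset[OF _ finite_permutations[OF finite_atLeastAtMost[of 1 n]]])
  also have "\<dots> \<le> (\<Sum>u\<in>?T. card {s. s \<circ> u \<in> G \<and> s permutes {1..n}})"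
    by (rule card_UN_le[OF finT])
  also have "\<dots> \<le> (\<Sum>u\<in>?T. card G)" by (intro sum_mono each)
  also have "\<dots> = 120 * card G" by (simp add: cardT)
  finally show ?thesis by (simp add: G_def)
qed

section \<open>Upper bound\<close>

lemma matching_two_edges:
  assumes "matching n M" "1 < card M"
  obtains a b c d where "{a, b} \<in> M" "{c, d} \<in> M" "{a, b, c, d} \<subseteq> {1..n}" "distinct [a, b, c, d]"
proof -
  obtain e f where ef: "e \<in> M" "f \<in> M" "e \<noteq> f"
    using assms(2) by (metis card_le_Suc0_iff_eq card.infinite leD One_nat_def not_one_less_zero)
  then obtain a b c d where "e = {a, b}" "a \<noteq> b" "f = {c, d}" "c \<noteq> d"
    using assms(1) unfolding matching_def card_2_iff by metis
  moreover have "e \<inter> f = {}" "e \<subseteq> {1..n}" "f \<subseteq> {1..n}"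
    using assms(1) ef by (auto simp: matching_def pairwise_def disjnt_def)
  ultimately show thesis using ef that[of a b c d] by auto
qed

text \<open>The constant is 480 = 4 * 120: there are at most \<open>n ^ 4\<close> targets, and each
  round keeps at most a fraction 1 - 1/120 of them.\<close>

lemma forcing_labelings_exist:
  assumes gp: "general_position P" and card: "card P = n" and n: "n \<ge> 5"
    and l: "real l > 480 * ln n"
  shows "\<exists>L. forcing_labelings n P l L"
proof -
  have "finite P" using card n by (intro card_ge_0_finite) simp
  then obtain p where p: "bij_betw p {1..n} P"
    using card by (metis ex_bij_betw_nat_finite_1)
  define B where "B = {s. s permutes {1..n}}"
  \<comment> \<open>Ordered quadruples of distinct labels encode the pairs of disjoint edges, with
    harmless repetition.\<close>
  define U where "U = {(a, b, c, d). {a, b, c, d} \<subseteq> {1..n} \<and> distinct [a, b, c, d]}"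
  define R where "R = (\<lambda>(s :: nat \<Rightarrow> nat) (a, b, c, d). crosses (p (s a)) (p (s b)) (p (s c)) (p (s d)))"
  have U4: "U \<subseteq> {1..n} \<times> {1..n} \<times> {1..n} \<times> {1..n}" by (auto simp: U_def)
  then have finU: "finite U" by (rule finite_subset) auto
  have "card U \<le> n ^ 4"
    using card_mono[OF _ U4] by (simp add: card_cartesian_product eval_nat_numeral)
  then have cardU: "real (card U) \<le> real n ^ 4"
    by (metis of_nat_le_iff of_nat_power)
  have B: "finite B" "B \<noteq> {}" using permutes_id[of "{1..n}"]
    by (auto simp: B_def finite_permutations simp del: permutes_id)
  have dense: "card B \<le> 120 * card {s \<in> B. R s t}" if "t \<in> U" for t
    using that crossing_permutations_dense[OF gp p n] by (auto simp: U_def R_def B_def)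
  have "\<exists>L. (\<forall>i<l. L i \<in> B) \<and>
    real (card {t \<in> U. \<forall>i<l. \<not> R (L i) t}) \<le> (1 - 1 / real 120) ^ l * card U"
    using B finU dense by (intro greedy_cover) simp_all
  then obtain L where L: "\<forall>i<l. L i \<in> B"
    and cL: "real (card {t \<in> U. \<forall>i<l. \<not> R (L i) t}) \<le> (1 - 1 / 120) ^ l * card U"
    by auto
  \<comment> \<open>By 1 + x <= exp x the surviving fraction is below \<open>1 / n ^ 4\<close>, so
    fewer than one target, hence none, survives.\<close>
  have "(1 - 1 / 120 :: real) ^ l \<le> exp (- (1 / 120)) ^ l"
    using exp_ge_add_one_self[of "- (1 / 120)"] by (intro power_mono) auto
  also have "\<dots> = exp (- (real l / 120))" by (simp add: exp_of_nat_mult[symmetric])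
  also have "\<dots> < exp (- (4 * ln n))" using l by simp
  also have "\<dots> = inverse (real n ^ 4)" using n by (simp add: exp_minus exp_of_nat_mult[where n = 4, simplified])
  finally have "(1 - 1 / 120 :: real) ^ l * real n ^ 4 < 1"
    using n by (simp add: field_simps)
  moreover have "(1 - 1 / 120 :: real) ^ l * card U \<le> (1 - 1 / 120) ^ l * real n ^ 4"
    using cardU by (intro mult_left_mono) auto
  ultimately have "card {t \<in> U. \<forall>i<l. \<not> R (L i) t} = 0" using cL by linarith
  then have "{t \<in> U. \<forall>i<l. \<not> R (L i) t} = {}"
    using finU by (subst (asm) card_0_eq) simp_all
  then have all: "\<exists>i<l. R (L i) t" if "t \<in> U" for t
    using that by blast
  have "labeling n P (p \<circ> L i)" if "i < l" for i
    using that L bij_betw_trans[OF permutes_imp_bij p] by (auto simp: B_def labeling_def)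
  moreover have "card M \<le> 1" if M: "matching n M" and cf: "\<forall>i<l. crossing_free (p \<circ> L i) M" for M
  proof (rule ccontr)
    assume "\<not> card M \<le> 1"
    then obtain a b c d where abcd: "{a, b} \<in> M" "{c, d} \<in> M" "{a, b, c, d} \<subseteq> {1..n}" "distinct [a, b, c, d]"
      using matching_two_edges[OF M] unfolding not_le by blast
    then obtain i where i: "i < l" "R (L i) (a, b, c, d)" using all[of "(a, b, c, d)"] by (auto simp: U_def)
    then have "closed_segment ((p \<circ> L i) a) ((p \<circ> L i) b) \<inter> closed_segment ((p \<circ> L i) c) ((p \<circ> L i) d) \<noteq> {}"
      by (auto simp: R_def dest: crosses_imp_segments_meet)
    \<comment> \<open>Disjoint edges share no label, so \<open>crossing_free\<close> would force the
      two segments to be disjoint.\<close>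
    moreover have "{a, b} \<inter> {c, d} = {}" "{a, b} \<noteq> {c, d}" using abcd(4) by auto
    ultimately show False
      using cf i(1) abcd(1,2) unfolding crossing_free_def by (metis image_empty subset_empty)
  qed
  ultimately show ?thesis
    unfolding forcing_labelings_def by (intro exI[of _ "\<lambda>i. p \<circ> L i"]) blast
qed

section \<open>Lower bound\<close>

lemma forcing_labelings_lower_bound:
  assumes gp: "general_position P" and n: "n \<ge> 5" and F: "forcing_labelings n P l L"
  shows "n \<le> 2 ^ l + 2"
proof (rule ccontr)
  assume "\<not> n \<le> 2 ^ l + 2"
  then have "card (Pow {..<l}) < card {3..n}" by (simp add: card_Pow)
  \<comment> \<open>The record of \<open>x\<close>: the copies in which it lies strictly to the left
    of the directed line from label 1 to label 2. The n - 2 labels from 3 on outnumber the possible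
    records.\<close>
  define side where "side x = {i. i < l \<and> 0 < orient (L i 1) (L i 2) (L i x)}" for x
  have "side ` {3..n} \<subseteq> Pow {..<l}" by (auto simp: side_def)
  then have "\<not> inj_on side {3..n}"
    using \<open>card (Pow {..<l}) < card {3..n}\<close> card_inj_on_le[of side "{3..n}" "Pow {..<l}"] by auto
  then obtain c d where cd: "c \<in> {3..n}" "d \<in> {3..n}" "c \<noteq> d" "side c = side d"
    by (auto simp: inj_on_def)
  define M where "M = {{1, 2}, {c, d}}"
  have "matching n M"
    using cd n by (auto simp: matching_def M_def pairwise_def disjnt_def)
  moreover have "crossing_free (L i) M" if i: "i < l" for i
  proof -
    have lab: "bij_betw (L i) {1..n} P" using F i by (auto simp: forcing_labelings_def labeling_def)
    have nz: "orient (L i 1) (L i 2) (L i x) \<noteq> 0" if "x \<in> {3..n}" for x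
      using that n bij_betwE[OF lab] bij_betw_imp_inj_on[OF lab, THEN inj_on_contraD]
      by (intro general_position_orient[OF gp]) auto
    \<comment> \<open>Since no orientation is zero, absence from the record means strictly to the
      right, so \<open>c\<close> and \<open>d\<close> are on the same strict side.\<close>
    have "i \<in> side c \<longleftrightarrow> i \<in> side d" using cd(4) by simp
    then have disj: "closed_segment (L i 1) (L i 2) \<inter> closed_segment (L i c) (L i d) = {}"
      using i nz[OF cd(1)] nz[OF cd(2)]
      by (intro same_side_imp_segments_disjoint) (auto simp: side_def)
    show ?thesis
      unfolding crossing_free_def M_def
      using disj by (auto simp: doubleton_eq_iff closed_segment_commute Int_commute)
  qed
  moreover have "card M = 2" using cd by (auto simp: M_def doubleton_eq_iff)
  ultimately show False using F unfolding forcing_labelings_def by fastforce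
qed

section \<open>Logarithmic form of both bounds\<close>

theorem theorem5:
  shows "\<exists>c1 c2 :: real. c1 > 0 \<and> c2 > 0 \<and>
    (\<forall>(n::nat) (P :: point set). n \<ge> 5 \<and> card P = n \<and> general_position P \<longrightarrow>
       ereal (c1 * ln (real n)) \<le> ereal_of_enat (force n P) \<and>
       ereal_of_enat (force n P) \<le> ereal (c2 * ln (real n)))"
proof (rule exI[of _ "1/2"], rule exI[of _ 481], intro conjI allI impI)
  fix n :: nat and P :: "point set"
  assume asm: "n \<ge> 5 \<and> card P = n \<and> general_position P"
  then have n: "n \<ge> 5" and card: "card P = n" and gp: "general_position P"
    by auto
  let ?A = "{enat l | l. \<exists>L. forcing_labelings n P l L}"
  have ln1: "1 \<le> ln (real n)"
    using n exp_le by (subst ln_ge_iff) auto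
  \<comment> \<open>The least natural number strictly above \<open>480 * ln n\<close>; as
    \<open>1 \<le> ln n\<close>, the rounding costs at most one more \<open>ln n\<close>, giving
    481.\<close>
  define m where "m = nat \<lfloor>480 * ln n\<rfloor> + 1"
  have m: "480 * ln n < real m" "real m \<le> 480 * ln n + 1" using ln1 by (auto simp: m_def) linarith+
  have mA: "enat m \<in> ?A" using forcing_labelings_exist[OF gp card n m(1)] by blast
  have "force n P \<le> enat m" unfolding force_def using mA by (rule Inf_lower)
  then have "ereal_of_enat (force n P) \<le> ereal m" by (metis ereal_of_enat_le_iff ereal_of_enat_simps(1))
  also have "\<dots> \<le> ereal (481 * ln n)" using m ln1 by simp
  finally show "ereal_of_enat (force n P) \<le> ereal (481 * ln n)" .
  \<comment> \<open>The infimum is attained because \<open>enat\<close> is well-ordered and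
    \<open>?A\<close> is nonempty.\<close>
  have "force n P \<in> ?A" unfolding force_def using mA by (rule wellorder_InfI)
  then obtain l L where l: "force n P = enat l" "forcing_labelings n P l L" by blast
  have "real n \<le> real (2 ^ l + 2)"
    using forcing_labelings_lower_bound[OF gp n l(2)] by (simp only: of_nat_le_iff)
  then have "real n \<le> 2 ^ l + 2" by simp
  \<comment> \<open>This turns \<open>n - 2 \<le> 2 ^ l\<close> into
    \<open>sqrt n \<le> 2 ^ l\<close>, whence the constant 1/2. It amounts to
    \<open>n \<le> (n - 2)\<^sup>2\<close>, where the difference factors as (n - 1)(n - 4).\<close>
  moreover have "sqrt n + 2 \<le> n"
  proof -
    have "sqrt n \<le> real n - 2"
    proof (rule real_le_lsqrt)
      have "0 \<le> (real n - 1) * (real n - 4)" using n by (intro mult_nonneg_nonneg) auto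
      then show "real n \<le> (real n - 2)\<^sup>2" by (simp add: power2_eq_square algebra_simps)
    qed (use n in auto)
    then show ?thesis by simp
  qed
  ultimately have "sqrt n \<le> 2 ^ l" by simp
  then have "ln (sqrt n) \<le> ln (2 ^ l :: real)" using n by (subst ln_le_cancel_iff) auto
  then have "ln n / 2 \<le> l * ln 2" using n by (simp add: ln_sqrt ln_realpow)
  also have "\<dots> \<le> l" using ln_2_less_1 by (simp add: mult_left_le)
  finally show "ereal (1 / 2 * ln n) \<le> ereal_of_enat (force n P)" by (simp add: l)
qed auto

end
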